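(* For every fixed integer $g\ge 3$, the sequence $\{C(\Delta,g)/\Delta\}_{\Delta\ge 3}$ is monotonically increasing in $\Delta$, and $$\lim_{\Delta\to\infty}\frac{C(\Delta,g)}{\Delta}\le K_g,$$ where $C(\Delta,g)$ and $K_g$ are the constants defined in the context.
   Context: Definition of $C(\Delta,g)$, for integers $\Delta\ge 3$ and $g\ge 3$. Let $$\rho_\Delta=\left(\frac{\Delta-1}{\Delta-2}\right)^{\Delta}.$$ For $b\in[1,\rho_\Delta)$ and $d\in\mathbb{N}$ put $$x_\Delta(b)=\frac{b^{2/\Delta}-b^{1/\Delta}}{b},\qquad f^d_\Delta(b)=\frac{1}{\Delta-1}\cdot\frac{\big[(\Delta-1)(1-b^{-1/\Delta})\big]^{d}}{1-(\Delta-1)(1-b^{-1/\Delta})}.$$ For $a\in[0,1]$ and $b\in[1,\rho_\Delta)$ put $$K^g_\Delta(a,b)=\big[1+(1-a)x_\Delta(b)\big]^{\Delta}-1+f^{g-2}_\Delta(b)\binom{\Delta}{2}\,b\,x_\Delta(b)\,\big(1+b\,x_\Delta(b)\big)^{\Delta-1},$$ $$b^g_\Delta(a)=\sup\{b\in[1,\rho_\Delta):\ K^g_\Delta(a,b)\le a\},\qquad z^g_\Delta(a)=(1-a)\,x_\Delta\big(b^g_\Delta(a)\big).$$ Finally $$C(\Delta,g)=\Big[\max_{a\in[0,1]}z^g_\Delta(a)\Big]^{-1}.$$ Definition of $K_g$ (the Jenssen–Patel–Regts constant), for an integer $g\ge 3$: $$K_g=\min_{a\in(0,1)}\left(\frac{b_g(a)}{(1-a)\ln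 b_g(a)}\right),$$ where $b_g(a)$ is the unique solution $b$, in the interval $[1,e)$, of the equation $$\exp\left\{\frac{(1-a)\ln b}{b}\right\}-1+\frac{b(\ln b)^{g-1}}{2(1-\ln b)}=a.$$ *)

theory Defs
  imports Complex_Main
begin

definition rho :: "nat \<Rightarrow> real" where
  "rho \<Delta> = ((real \<Delta> - 1) / (real \<Delta> - 2)) ^ \<Delta>"

definition x_fun :: "nat \<Rightarrow> real \<Rightarrow> real" where
  "x_fun \<Delta> b = (b powr (2 / real \<Delta>) - b powr (1 / real \<Delta>)) / b"

definition f_fun :: "nat \<Rightarrow> nat \<Rightarrow> real \<Rightarrow> real" where
  "f_fun \<Delta> d b =
     1 / (real \<Delta> - 1) *
     (((real \<Delta> - 1) * (1 - b powr (- 1 / real \<Delta>))) ^ d /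
      (1 - (real \<Delta> - 1) * (1 - b powr (- 1 / real \<Delta>))))"

definition K_fun :: "nat \<Rightarrow> nat \<Rightarrow> real \<Rightarrow> real \<Rightarrow> real" where
  "K_fun \<Delta> g a b =
     (1 + (1 - a) * x_fun \<Delta> b) ^ \<Delta> - 1 +
     f_fun \<Delta> (g - 2) b * real (\<Delta> choose 2) * b * x_fun \<Delta> b *
       (1 + b * x_fun \<Delta> b) ^ (\<Delta> - 1)"

definition b_sup :: "nat \<Rightarrow> nat \<Rightarrow> real \<Rightarrow> real" where
  "b_sup \<Delta> g a = Sup {b. 1 \<le> b \<and> b < rho \<Delta> \<and> K_fun \<Delta> g a b \<le> a}"

definition z_fun :: "nat \<Rightarrow> nat \<Rightarrow> real \<Rightarrow> real" where
  "z_fun \<Delta> g a = (1 - a) * x_fun \<Delta> (b_sup \<Delta> g a)"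

(* The extrema in C_const and JPR_const are over infinite sets, so Max and Min do not
   apply; GREATEST and LEAST are attained extrema, unlike Sup and Inf. *)
definition C_const :: "nat \<Rightarrow> nat \<Rightarrow> real" where
  "C_const \<Delta> g = inverse (GREATEST m. m \<in> z_fun \<Delta> g ` {0..1})"

definition JPR_b :: "nat \<Rightarrow> real \<Rightarrow> real" where
  "JPR_b g a = (THE b. 1 \<le> b \<and> b < exp 1 \<and>
     exp ((1 - a) * ln b / b) - 1 + b * ln b ^ (g - 1) / (2 * (1 - ln b)) = a)"

definition JPR_const :: "nat \<Rightarrow> real" where
  "JPR_const g =
     (LEAST m. m \<in> (\<lambda>a. JPR_b g a / ((1 - a) * ln (JPR_b g a))) ` {0<..<1})"

end

theory Submission
  imports Defs "HOL-Analysis.Analysis"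
begin

text \<open>
  Parametrise \<open>b = u ^ \<Delta>\<close> and \<open>s = (\<Delta> - 1) (1 - 1 / u)\<close>, which maps \<open>[1, \<rho>)\<close> onto \<open>[0, 1)\<close>.
  With \<open>X = \<Delta> x(b)\<close> and \<open>Y = b (1 + b x(b)) ^ (\<Delta> - 1)\<close>, the inequality \<open>K(a, b) \<le> a\<close> becomes
  \<open>E ((1 - a) X) + s ^ (g - 2) / (1 - s) * X Y / 2 \<le> a\<close>, where \<open>E w = (1 + w / \<Delta>) ^ \<Delta> - 1\<close>, and
  \<open>C(\<Delta>, g) / \<Delta>\<close> is the inverse of the maximum over \<open>a\<close> of \<open>(1 - a) X\<close> at the largest admissible
  \<open>s\<close>. The constant \<open>K\<^sub>g\<close> has the same shape with the limits \<open>E w = e\<^sup>w - 1\<close>, \<open>X = s / e\<^sup>s\<close>,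
  \<open>Y = e\<^sup>2\<^sup>s\<close>. For a fixed value of \<open>t = \<Delta> (u - 1)\<close>, as \<open>\<Delta>\<close> grows, \<open>X\<close> decreases while
  \<open>s\<close>, \<open>Y\<close> and \<open>E\<close> increase; hence the maximum decreases and stays above its limit value.
\<close>

section \<open>The common root and maximum problem for finite degree and for the limit\<close>

locale girth_system =
  fixes E X Y :: "real \<Rightarrow> real" and d :: nat
  assumes d_pos: "d > 0"
    and E_cont: "continuous_on UNIV E"
    and E_mono: "mono_on {0..} E"
    and E_0: "E 0 = 0"
    and X_cont: "continuous_on {0..1} X"
    and X_mono: "mono_on {0..1} X"
    and X_0: "X 0 = 0"
    and X_pos: "\<And>s. 0 < s \<Longrightarrow> s \<le> 1 \<Longrightarrow> 0 < X s"
    and Y_cont: "continuous_on {0..1} Y"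
    and Y_mono: "mono_on {0..1} Y"
    and Y_pos: "\<And>s. 0 \<le> s \<Longrightarrow> s \<le> 1 \<Longrightarrow> 0 < Y s"
begin

definition K :: "real \<Rightarrow> real \<Rightarrow> real" where
  "K a s = E ((1 - a) * X s) + s ^ d / (1 - s) * X s * Y s / 2"

definition root :: "real \<Rightarrow> real" where
  "root a = (THE s. 0 \<le> s \<and> s < 1 \<and> K a s = a)"

definition V :: "real \<Rightarrow> real" where
  "V a = (1 - a) * X (root a)"

text \<open>\<^term>\<open>K a s = a\<close> cleared of its denominator, so that \<^term>\<open>s = 1\<close> can be included.\<close>

definition H :: "real \<Rightarrow> real \<Rightarrow> real" where
  "H a s = (1 - s) * (E ((1 - a) * X s) - a) + s ^ d * X s * Y s / 2"

lemma X_nonneg: "0 \<le> s \<Longrightarrow> s \<le> 1 \<Longrightarrow> 0 \<le> X s"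
  using X_pos[of s] X_0 by (cases "s = 0") auto

lemma X_le: "0 \<le> s \<Longrightarrow> s \<le> r \<Longrightarrow> r \<le> 1 \<Longrightarrow> X s \<le> X r"
  using X_mono by (auto simp: mono_on_def)

lemma Y_le: "0 \<le> s \<Longrightarrow> s \<le> r \<Longrightarrow> r \<le> 1 \<Longrightarrow> Y s \<le> Y r"
  using Y_mono by (auto simp: mono_on_def)

lemma E_le: "0 \<le> v \<Longrightarrow> v \<le> w \<Longrightarrow> E v \<le> E w"
  using E_mono by (auto simp: mono_on_def)

lemma K_0: "K a 0 = 0"
  by (simp add: K_def X_0 E_0)

text \<open>Strictness comes from the factor \<open>s ^ d / (1 - s)\<close>; the remaining factors
  are weakly increasing, and \<open>X r * Y r\<close> is positive.\<close>

lemma K_less: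
  assumes "a \<le> 1" "0 \<le> s" "s < r" "r < 1"
  shows "K a s < K a r"
proof -
  have "s ^ d < r ^ d"
    using assms d_pos by (intro power_strict_mono) auto
  then have "s ^ d / (1 - s) < r ^ d / (1 - r)"
    using assms by (intro frac_less) auto
  moreover have "X s * Y s \<le> X r * Y r"
    using assms X_le[of s r] Y_le[of s r] X_nonneg[of r] Y_pos[of s]
    by (intro mult_mono) auto
  moreover have "0 < X r * Y r"
    using X_pos[of r] Y_pos[of r] assms by simp
  moreover have "0 \<le> s ^ d / (1 - s)"
    using assms by simp
  ultimately have "s ^ d / (1 - s) * (X s * Y s) < r ^ d / (1 - r) * (X r * Y r)"
    using mult_left_mono[of "X s * Y s" "X r * Y r" "s ^ d / (1 - s)"]
      mult_strict_right_mono[of "s ^ d / (1 - s)" "r ^ d / (1 - r)" "X r * Y r"]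
    by linarith
  moreover have "E ((1 - a) * X s) \<le> E ((1 - a) * X r)"
    using assms X_le[of s r] X_nonneg[of s] by (intro E_le mult_left_mono) auto
  ultimately show ?thesis
    unfolding K_def mult.assoc by (intro add_le_less_mono divide_strict_right_mono) auto
qed

lemma H_eq: "s < 1 \<Longrightarrow> H a s = (1 - s) * (K a s - a)"
  by (simp add: H_def K_def field_simps)

lemma H_1: "H a 1 > 0"
  using X_pos[of 1] Y_pos[of 1] by (simp add: H_def)

lemma H_zero_iff: "s \<le> 1 \<Longrightarrow> H a s = 0 \<longleftrightarrow> s < 1 \<and> K a s = a"
  using H_1[of a] H_eq[of s a] by (cases "s = 1") auto

lemma continuous_on_H: "continuous_on ({0..1} \<times> {0..1}) (\<lambda>(a, s). H a s)"
proof -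
  have X: "continuous_on ({0..1} \<times> {0..1}) (\<lambda>p. X (snd p))"
    by (rule continuous_on_compose2[OF X_cont]) (auto intro!: continuous_intros)
  have Y: "continuous_on ({0..1} \<times> {0..1}) (\<lambda>p. Y (snd p))"
    by (rule continuous_on_compose2[OF Y_cont]) (auto intro!: continuous_intros)
  have "continuous_on ({0..1} \<times> {0..1}) (\<lambda>p. E ((1 - fst p) * X (snd p)))"
    by (rule continuous_on_compose2[OF E_cont]) (auto intro!: continuous_intros X)
  with X Y show ?thesis
    unfolding H_def split_def by (intro continuous_intros) auto
qed

text \<open>\<open>H a\<close> runs from \<open>- a\<close> at 0 to a positive value at 1, so the
  intermediate value theorem gives a zero, which lies below 1. Strict monotonicity of
  \<open>K a\<close> makes it unique.\<close>

lemma root_exists: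
  assumes "0 \<le> a" "a \<le> 1"
  shows "\<exists>!s. 0 \<le> s \<and> s < 1 \<and> K a s = a"
proof -
  have "continuous_on {0..1} (\<lambda>s. (\<lambda>(a, s). H a s) (a, s))"
    by (rule continuous_on_compose2[OF continuous_on_H])
      (use assms in \<open>auto intro!: continuous_intros\<close>)
  then have "\<exists>s. 0 \<le> s \<and> s \<le> 1 \<and> H a s = 0"
    using IVT'[of "H a" 0 0 1] H_eq[of 0 a] H_1[of a] assms by (auto simp: K_0)
  then obtain s where "0 \<le> s" "s < 1" "K a s = a"
    using H_zero_iff by blast
  moreover have "s = r" if "0 \<le> r" "r < 1" "K a r = a" for r
    using K_less[of a s r] K_less[of a r s] calculation that assms
    by (cases s r rule: linorder_cases) simp_all
  ultimately show ?thesis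
    by blast
qed

lemma root:
  assumes "0 \<le> a" "a \<le> 1"
  shows "0 \<le> root a" "root a < 1" "K a (root a) = a"
  using theI'[OF root_exists[OF assms]] by (auto simp: root_def)

text \<open>Monotonicity makes the root the largest admissible parameter. This reconciles the
  supremum in \<open>b_sup\<close> with the equation in \<open>JPR_b\<close>.\<close>

lemma K_le_iff:
  assumes "0 \<le> a" "a \<le> 1" "0 \<le> s" "s < 1"
  shows "K a s \<le> a \<longleftrightarrow> s \<le> root a"
  using root[OF assms(1,2)] K_less[of a s "root a"] K_less[of a "root a" s] assms
  by (cases s "root a" rule: linorder_cases) simp_all

lemma V_pos:
  assumes "0 < a" "a < 1"
  shows "0 < root a" "0 < V a"
proof -
  show "0 < root a"
    using root[of a] K_0[of a] assms by (cases "root a = 0") simp_all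
  then show "0 < V a"
    using root[of a] X_pos[of "root a"] assms by (simp add: V_def)
qed

lemma V_0: "V 0 = 0"
proof -
  have "root 0 = 0"
    using root[of 0] K_less[of 0 0 "root 0"] by (cases "root 0 = 0") (simp_all add: K_0)
  then show ?thesis
    by (simp add: V_def X_0)
qed

lemma V_attains_max: "\<exists>a\<in>{0<..<1}. \<forall>c\<in>{0..1}. V c \<le> V a"
proof -
  define Z where "Z = {p \<in> {0..1} \<times> {0..1}. (\<lambda>(a, s). H a s) p = 0}"
  have "closed Z"
    unfolding Z_def
    by (intro continuous_closed_preimage_constant continuous_on_H closed_Times) auto
  moreover have "Z = ({0..1} \<times> {0..1}) \<inter> Z"
    by (auto simp: Z_def)
  ultimately have "compact Z"
    by (metis compact_Icc compact_Times compact_Int_closed)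
  have Z: "(a, root a) \<in> Z" if "a \<in> {0..1}" for a
    using root[of a] H_zero_iff[of "root a" a] that by (auto simp: Z_def)
  have Z_root: "s = root a" "a \<in> {0..1}" if "(a, s) \<in> Z" for a s
    using root_exists[of a] root[of a] H_zero_iff[of s a] that by (auto simp: Z_def)
  have "continuous_on Z (\<lambda>p. X (snd p))"
    by (rule continuous_on_compose2[OF X_cont]) (auto simp: Z_def intro!: continuous_intros)
  then have "continuous_on Z (\<lambda>p. (1 - fst p) * X (snd p))"
    by (intro continuous_intros)
  moreover have "Z \<noteq> {}"
    using Z[of 0] by auto
  ultimately obtain p where p: "p \<in> Z"
    "\<And>q. q \<in> Z \<Longrightarrow> (1 - fst q) * X (snd q) \<le> (1 - fst p) * X (snd p)"
    using continuous_attains_sup[OF \<open>compact Z\<close>] by blast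
  have "(fst p, snd p) \<in> Z"
    using p(1) by simp
  from Z_root[OF this] have p_eq: "p = (fst p, root (fst p))" "fst p \<in> {0..1}"
    by (simp_all add: prod_eq_iff)
  have max: "V c \<le> V (fst p)" if "c \<in> {0..1}" for c
    using p(2)[OF Z[OF that]] p_eq by (metis V_def fst_conv snd_conv)
  \<comment> \<open>\<open>V\<close> vanishes at both endpoints, so a positive maximum is attained
    in the open interval, over which the minimum in \<open>JPR_const\<close> is taken.\<close>
  have "V (fst p) > 0"
    using max[of "1/2"] V_pos[of "1/2"] by simp
  then have "fst p \<in> {0<..<1}"
    using p_eq(2) V_0 by (cases "fst p = 0"; cases "fst p = 1") (auto simp: V_def)
  with max show ?thesis
    by blast
qed

definition Vmax :: real where
  "Vmax = (GREATEST v. v \<in> V ` {0..1})"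

lemma Vmax:
  shows Vmax_attained: "\<exists>a\<in>{0<..<1}. V a = Vmax"
    and V_le_Vmax: "\<And>c. c \<in> {0..1} \<Longrightarrow> V c \<le> Vmax"
    and Vmax_pos: "Vmax > 0"
proof -
  obtain a where a: "a \<in> {0<..<1}" "\<forall>c\<in>{0..1}. V c \<le> V a"
    using V_attains_max by blast
  then have "Vmax = V a"
    unfolding Vmax_def by (intro Greatest_equality) auto
  then show "\<exists>a\<in>{0<..<1}. V a = Vmax" "\<And>c. c \<in> {0..1} \<Longrightarrow> V c \<le> Vmax" "Vmax > 0"
    using a V_pos by auto
qed

end

text \<open>A maximiser \<open>a\<close> of the second system is tested in the first one. A point
  \<open>q\<close> with \<open>X1 q = X2 r\<close> that is still admissible for \<open>a\<close>
  there shows that the first system reaches at least the same value.\<close>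

lemma girth_system_Vmax_mono:
  assumes S1: "girth_system E1 X1 Y1 d" and S2: "girth_system E2 X2 Y2 d"
    and E: "\<And>w. 0 \<le> w \<Longrightarrow> E1 w \<le> E2 w"
    and XY: "\<And>r. 0 \<le> r \<Longrightarrow> r < 1 \<Longrightarrow> \<exists>s. 0 \<le> s \<and> s \<le> r \<and> X2 r \<le> X1 s \<and> Y1 s \<le> Y2 r"
  shows "girth_system.Vmax E2 X2 Y2 d \<le> girth_system.Vmax E1 X1 Y1 d"
proof -
  interpret S1: girth_system E1 X1 Y1 d by fact
  interpret S2: girth_system E2 X2 Y2 d by fact
  obtain a where a: "a \<in> {0<..<1}" "S2.V a = S2.Vmax"
    using S2.Vmax_attained by blast
  define r where "r = S2.root a"
  have r: "0 \<le> r" "r < 1" "S2.K a r = a"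
    using S2.root[of a] a by (auto simp: r_def)
  obtain s where s: "0 \<le> s" "s \<le> r" "X2 r \<le> X1 s" "Y1 s \<le> Y2 r"
    using XY r by blast
  have "continuous_on {0..s} X1"
    using S1.X_cont s r by (elim continuous_on_subset) auto
  \<comment> \<open>The point \<open>s\<close> may fail to be admissible, since a larger
    \<open>X1 s\<close> also enlarges \<open>S1.K\<close>. Moving down to equality of the
    \<open>X\<close> values repairs this, and \<open>Y1\<close> only decreases.\<close>
  then obtain q where q: "0 \<le> q" "q \<le> s" "X1 q = X2 r"
    using IVT'[of X1 0 "X2 r" s] s S1.X_0 S2.X_nonneg[of r] r by auto
  have "q ^ d / (1 - q) * X1 q * Y1 q \<le> r ^ d / (1 - r) * X2 r * Y2 r"
    using q s r S1.Y_le[of q s] S1.Y_pos[of q] S2.X_nonneg[of r]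
    by (intro mult_mono frac_le power_mono) auto
  moreover have "E1 ((1 - a) * X1 q) \<le> E2 ((1 - a) * X2 r)"
    using a S2.X_nonneg[of r] r by (simp add: E q)
  ultimately have "S1.K a q \<le> S2.K a r"
    unfolding S1.K_def S2.K_def by (intro add_mono divide_right_mono) auto
  then have "q \<le> S1.root a"
    using S1.K_le_iff[of a q] a q s r by auto
  then have "X2 r \<le> X1 (S1.root a)"
    using S1.X_le[of q "S1.root a"] S1.root[of a] a q by auto
  then have "S2.V a \<le> S1.V a"
    unfolding S1.V_def S2.V_def r_def[symmetric] using a by (intro mult_left_mono) auto
  also have "\<dots> \<le> S1.Vmax"
    using a by (intro S1.V_le_Vmax) auto
  finally show ?thesis
    by (simp add: a)
qed

section \<open>The system for finite degree\<close>

text \<open>The \<Delta>-th root u of b, recovered from s = (\<Delta> - 1)(1 - 1/u).\<close>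

definition U :: "nat \<Rightarrow> real \<Rightarrow> real" where
  "U \<Delta> s = (real \<Delta> - 1) / (real \<Delta> - 1 - s)"

definition E_fin :: "nat \<Rightarrow> real \<Rightarrow> real" where
  "E_fin \<Delta> w = (1 + w / real \<Delta>) ^ \<Delta> - 1"

definition X_fin :: "nat \<Rightarrow> real \<Rightarrow> real" where
  "X_fin \<Delta> s = real \<Delta> * ((U \<Delta> s - 1) / U \<Delta> s ^ (\<Delta> - 1))"

definition Y_fin :: "nat \<Rightarrow> real \<Rightarrow> real" where
  "Y_fin \<Delta> s = U \<Delta> s ^ \<Delta> * (1 + U \<Delta> s * (U \<Delta> s - 1)) ^ (\<Delta> - 1)"

lemma U_ge_1: "\<Delta> \<ge> 3 \<Longrightarrow> 0 \<le> s \<Longrightarrow> s \<le> 1 \<Longrightarrow> 1 \<le> U \<Delta> s"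
  by (simp add: U_def field_simps)

lemma U_mono: "\<Delta> \<ge> 3 \<Longrightarrow> 0 \<le> s \<Longrightarrow> s \<le> r \<Longrightarrow> r \<le> 1 \<Longrightarrow> U \<Delta> s \<le> U \<Delta> r"
  unfolding U_def by (intro divide_left_mono) auto

lemma continuous_on_U: "\<Delta> \<ge> 3 \<Longrightarrow> continuous_on {0..1} (U \<Delta>)"
  unfolding U_def by (intro continuous_intros) auto

text \<open>The derivative of \<open>(v - 1) / v ^ n\<close> has the sign of
  \<open>v - n * (v - 1)\<close>. Instead of differentiating, the ratio of the two numerators is
  bounded by \<open>(u / v) ^ n\<close> through the Bernoulli inequality.\<close>

lemma frac_power_mono:
  fixes u v :: real
  assumes "1 \<le> u" "u \<le> v" "real n * (v - 1) \<le> v"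
  shows "(u - 1) / u ^ n \<le> (v - 1) / v ^ n"
proof (cases "v = 1")
  case False
  with assms have v: "v > 1" by auto
  have "real n * (v - u) * (v - 1) \<le> (v - u) * v"
    using mult_left_mono[OF assms(3), of "v - u"] assms by (simp add: mult_ac)
  then have "(u - 1) / (v - 1) \<le> 1 + real n * (u / v - 1)"
    using v by (simp add: field_simps)
  also have "\<dots> \<le> (u / v) ^ n"
    using Bernoulli_inequality[of "u / v - 1" n] assms v by simp
  finally show ?thesis
    using v assms by (simp add: field_simps power_divide)
qed (use assms in simp)

lemma girth_system_fin:
  assumes D: "\<Delta> \<ge> 3" and d: "d > 0"
  shows "girth_system (E_fin \<Delta>) (X_fin \<Delta>) (Y_fin \<Delta>) d"
proof
  show "continuous_on UNIV (E_fin \<Delta>)"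
    unfolding E_fin_def by (intro continuous_intros) (use D in auto)
  show "mono_on {0..} (E_fin \<Delta>)"
    using D by (auto simp: mono_on_def E_fin_def intro!: power_mono divide_right_mono)
  show "E_fin \<Delta> 0 = 0"
    by (simp add: E_fin_def)
  show "X_fin \<Delta> 0 = 0"
    using D by (simp add: X_fin_def U_def)
  have U_nz: "U \<Delta> s \<noteq> 0" if "s \<in> {0..1}" for s
    using U_ge_1[OF D, of s] that by auto
  show "continuous_on {0..1} (X_fin \<Delta>)" "continuous_on {0..1} (Y_fin \<Delta>)"
    unfolding X_fin_def Y_fin_def
    by (intro continuous_intros continuous_on_U D ballI power_not_zero U_nz; assumption)+
  show "mono_on {0..1} (X_fin \<Delta>)"
  proof (rule mono_onI)
    fix s r :: real assume sr: "s \<in> {0..1}" "r \<in> {0..1}" "s \<le> r"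
    \<comment> \<open>With n = \<Delta> - 1 the condition of \<open>frac_power_mono\<close> amounts
      to r \<le> 1, with equality at r = 1.\<close>
    have "U \<Delta> r - 1 = r / (real \<Delta> - 1 - r)"
      using D sr by (simp add: U_def field_simps)
    moreover have "(real \<Delta> - 1) * (r / (real \<Delta> - 1 - r)) \<le> (real \<Delta> - 1) * (1 / (real \<Delta> - 1 - r))"
      using D sr by (intro mult_left_mono divide_right_mono) auto
    ultimately have "real (\<Delta> - 1) * (U \<Delta> r - 1) \<le> U \<Delta> r"
      using D by (simp add: U_def of_nat_diff)
    then show "X_fin \<Delta> s \<le> X_fin \<Delta> r"
      unfolding X_fin_def using U_ge_1[OF D] U_mono[OF D] sr
      by (intro mult_left_mono frac_power_mono) auto
  qed
  show "mono_on {0..1} (Y_fin \<Delta>)"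
  proof (rule mono_onI)
    fix s r :: real assume "s \<in> {0..1}" "r \<in> {0..1}" "s \<le> r"
    then have u: "1 \<le> U \<Delta> s" "U \<Delta> s \<le> U \<Delta> r"
      using U_ge_1[OF D] U_mono[OF D] by auto
    then have "U \<Delta> s * (U \<Delta> s - 1) \<le> U \<Delta> r * (U \<Delta> r - 1)" "0 \<le> U \<Delta> s * (U \<Delta> s - 1)"
      by (auto intro: mult_mono)
    with u show "Y_fin \<Delta> s \<le> Y_fin \<Delta> r"
      unfolding Y_fin_def by (intro mult_mono power_mono) auto
  qed
  show "0 < X_fin \<Delta> s" if "0 < s" "s \<le> 1" for s
  proof -
    have "1 < U \<Delta> s"
      using D that by (simp add: U_def field_simps)
    with D show ?thesis
      by (simp add: X_fin_def)
  qed
  show "0 < Y_fin \<Delta> s" if "0 \<le> s" "s \<le> 1" for s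
    using U_ge_1[OF D that] by (auto simp: Y_fin_def intro!: mult_pos_pos zero_less_power add_pos_nonneg)
qed (fact d)

section \<open>The limit system, with b = exp s\<close>

definition E_inf :: "real \<Rightarrow> real" where "E_inf w = exp w - 1"
definition X_inf :: "real \<Rightarrow> real" where "X_inf s = s / exp s"
text \<open>Kept as a product because its factors bound the two factors of \<open>Y_fin\<close> one
  by one.\<close>

definition Y_inf :: "real \<Rightarrow> real" where "Y_inf s = exp s * exp s"

lemma girth_system_inf:
  assumes "d > 0"
  shows "girth_system E_inf X_inf Y_inf d"
proof
  show "continuous_on UNIV E_inf" "continuous_on {0..1} X_inf" "continuous_on {0..1} Y_inf"
    unfolding E_inf_def X_inf_def Y_inf_def by (intro continuous_intros; simp)+
  show "mono_on {0..1} X_inf"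
  proof (rule mono_onI)
    fix s r :: real assume sr: "s \<in> {0..1}" "r \<in> {0..1}" "s \<le> r"
    have "s \<le> r * (1 + (s - r))"
      using mult_nonneg_nonneg[of "r - s" "1 - r"] sr by (simp add: algebra_simps)
    also have "\<dots> \<le> r * exp (s - r)"
      using sr by (intro mult_left_mono exp_ge_add_one_self) auto
    finally show "X_inf s \<le> X_inf r"
      by (simp add: X_inf_def exp_diff field_simps)
  qed
  show "mono_on {0..1} Y_inf"
    by (auto simp: mono_on_def Y_inf_def intro!: mult_mono)
qed (auto simp: E_inf_def X_inf_def Y_inf_def assms mono_on_def)

section \<open>Comparison of consecutive degrees, and with the limit, at fixed t\<close>

text \<open>This is the inequality of arithmetic and geometric means for k copies of 1 + y and a
  single 1, whose mean is 1 + t; it is derived here from the Bernoulli inequality for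
  \<open>(1 + t) / (1 + y)\<close>.\<close>

lemma power_le_power_Suc:
  fixes y z :: real
  assumes "0 \<le> y" "real k * y \<le> real (Suc k) * z"
  shows "(1 + y) ^ k \<le> (1 + z) ^ Suc k"
proof -
  define t where "t = real k * y / real (Suc k)"
  have t: "0 \<le> t" "t \<le> z"
    using assms by (simp_all add: t_def field_simps)
  have "real (Suc k) * (t - y) = - y"
    by (simp add: t_def field_simps)
  then have "1 / (1 + y) = 1 + real (Suc k) * (t - y) / (1 + y)"
    using assms(1) by (simp add: field_simps)
  also have "\<dots> = 1 + real (Suc k) * ((1 + t) / (1 + y) - 1)"
    using assms(1) by (simp add: diff_divide_distrib flip: add_divide_distrib) (simp add: field_simps)
  also have "\<dots> \<le> ((1 + t) / (1 + y)) ^ Suc k"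
    using Bernoulli_inequality[of "(1 + t) / (1 + y) - 1" "Suc k"] t(1) assms(1) by simp
  finally have "1 / (1 + y) * (1 + y) ^ Suc k \<le> ((1 + t) / (1 + y)) ^ Suc k * (1 + y) ^ Suc k"
    using assms(1) by (intro mult_right_mono) auto
  then have "(1 + y) ^ k \<le> (1 + t) ^ Suc k"
    using assms(1) by (simp only: flip: power_mult_distrib) simp
  also have "\<dots> \<le> (1 + z) ^ Suc k"
    using t by (intro power_mono) auto
  finally show ?thesis .
qed

text \<open>The inverse of \<^term>\<open>\<lambda>s. real \<Delta> * (U \<Delta> s - 1)\<close>.\<close>

definition s_of :: "nat \<Rightarrow> real \<Rightarrow> real" where
  "s_of \<Delta> t = (real \<Delta> - 1) * t / (real \<Delta> + t)"

lemma U_s_of: "\<Delta> \<ge> 3 \<Longrightarrow> 0 \<le> t \<Longrightarrow> U \<Delta> (s_of \<Delta> t) = 1 + t / real \<Delta>"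
  by (simp add: U_def s_of_def field_simps)

lemma X_fin_s_of: "\<Delta> \<ge> 3 \<Longrightarrow> 0 \<le> t \<Longrightarrow> X_fin \<Delta> (s_of \<Delta> t) = t / (1 + t / real \<Delta>) ^ (\<Delta> - 1)"
  by (simp add: X_fin_def U_s_of)

lemma Y_fin_s_of:
  "\<Delta> \<ge> 3 \<Longrightarrow> 0 \<le> t \<Longrightarrow> Y_fin \<Delta> (s_of \<Delta> t) =
     (1 + t / real \<Delta>) ^ \<Delta> * (1 + (1 + t / real \<Delta>) * (t / real \<Delta>)) ^ (\<Delta> - 1)"
  by (simp add: Y_fin_def U_s_of)

abbreviation Vmax_fin :: "nat \<Rightarrow> nat \<Rightarrow> real" where
  "Vmax_fin \<Delta> d \<equiv> girth_system.Vmax (E_fin \<Delta>) (X_fin \<Delta>) (Y_fin \<Delta>) d"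

abbreviation Vmax_inf :: "nat \<Rightarrow> real" where
  "Vmax_inf d \<equiv> girth_system.Vmax E_inf X_inf Y_inf d"

lemma power_le_exp:
  fixes y :: real
  assumes "0 \<le> y" "real n * y \<le> w"
  shows "(1 + y) ^ n \<le> exp w"
proof -
  have "(1 + y) ^ n \<le> exp y ^ n"
    using assms by (intro power_mono exp_ge_add_one_self) auto
  also have "\<dots> \<le> exp w"
    using assms by (simp flip: exp_of_nat_mult)
  finally show ?thesis .
qed

text \<open>Supplies the hypothesis of \<open>power_le_power_Suc\<close> for the second factor of
  \<open>Y_fin\<close>, with x = \<Delta>. Over a common denominator the difference of the sides is
  a nonnegative multiple of \<open>x * (x + 1 - t * (x - 1)) + t\<close>.\<close>

lemma quadratic_step:
  fixes x t :: real
  assumes "0 < x" "0 \<le> t" "t * (x - 1) \<le> x + 1"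
  shows "(x - 1) * ((1 + t / x) * (t / x)) \<le> x * ((1 + t / (x + 1)) * (t / (x + 1)))"
proof -
  have "0 \<le> x * (x + 1 - t * (x - 1)) + t"
    using assms by simp
  also have "\<dots> = x ^ 3 * (x + 1 + t) - (x - 1) * (x + t) * (x + 1) ^ 2"
    by (simp add: algebra_simps power2_eq_square power3_eq_cube)
  finally have "t * ((x - 1) * (x + t) * (x + 1) ^ 2) / (x ^ 2 * (x + 1) ^ 2)
      \<le> t * (x ^ 3 * (x + 1 + t)) / (x ^ 2 * (x + 1) ^ 2)"
    using assms by (intro divide_right_mono mult_left_mono) auto
  moreover have "(x - 1) * ((1 + t / x) * (t / x))
      = t * ((x - 1) * (x + t) * (x + 1) ^ 2) / (x ^ 2 * (x + 1) ^ 2)"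
    using assms(1) by (simp add: divide_simps power2_eq_square)
  moreover have "x * ((1 + t / (x + 1)) * (t / (x + 1)))
      = t * (x ^ 3 * (x + 1 + t)) / (x ^ 2 * (x + 1) ^ 2)"
    using assms(1) by (simp add: divide_simps power2_eq_square power3_eq_cube)
  ultimately show ?thesis
    by simp
qed

lemma Vmax_fin_Suc_le:
  assumes D: "\<Delta> \<ge> 3" and d: "d > 0"
  shows "Vmax_fin (Suc \<Delta>) d \<le> Vmax_fin \<Delta> d"
proof (rule girth_system_Vmax_mono)
  show "girth_system (E_fin \<Delta>) (X_fin \<Delta>) (Y_fin \<Delta>) d"
    "girth_system (E_fin (Suc \<Delta>)) (X_fin (Suc \<Delta>)) (Y_fin (Suc \<Delta>)) d"
    using D d by (auto intro: girth_system_fin)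
  obtain k where k: "\<Delta> = Suc k"
    using D by (cases \<Delta>) auto
  have step: "(1 + t / real \<Delta>) ^ \<Delta> \<le> (1 + t / real (Suc \<Delta>)) ^ Suc \<Delta>" if "0 \<le> t" for t
    using D that by (intro power_le_power_Suc) auto
  then show "E_fin \<Delta> w \<le> E_fin (Suc \<Delta>) w" if "0 \<le> w" for w
    using that unfolding E_fin_def by simp
  fix r :: real assume r: "0 \<le> r" "r < 1"
  \<comment> \<open>The solution of \<open>s_of (Suc \<Delta>) t = r\<close>; the comparison point
    for degree \<Delta> is then \<open>s_of \<Delta> t\<close>.\<close>
  define t where "t = (real \<Delta> + 1) * r / (real \<Delta> - r)"
  have t: "0 \<le> t"
    using D r by (simp add: t_def)
  \<comment> \<open>The bound r < 1 expressed in t, as \<open>quadratic_step\<close>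
    requires.\<close>
  have t_le: "t * (real \<Delta> - 1) \<le> real \<Delta> + 1"
  proof -
    have "r * (real \<Delta> - 1) \<le> real \<Delta> - r"
      using mult_left_mono[of r 1 "real \<Delta>"] r by (simp add: algebra_simps)
    then have "(real \<Delta> + 1) * (r * (real \<Delta> - 1)) \<le> (real \<Delta> + 1) * (real \<Delta> - r)"
      by (intro mult_left_mono) auto
    then show ?thesis
      using D r by (simp add: t_def divide_le_eq mult.assoc)
  qed
  have r_eq: "s_of (Suc \<Delta>) t = r"
  proof -
    have "real (Suc \<Delta>) + t = (real \<Delta> + 1) * real \<Delta> / (real \<Delta> - r)"
      using D r by (simp add: t_def field_simps)
    then show ?thesis
      unfolding s_of_def using D r by (simp add: t_def)
  qed
  have s_le: "s_of \<Delta> t \<le> s_of (Suc \<Delta>) t"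
    unfolding s_of_def using D t by (simp add: field_simps)
  have XX: "(1 + t / real \<Delta>) ^ (\<Delta> - 1) \<le> (1 + t / real (Suc \<Delta>)) ^ \<Delta>"
  proof -
    have "real k * (t / real \<Delta>) \<le> real (Suc k) * (t / real (Suc \<Delta>))"
      unfolding k using t by (simp add: field_simps)
    then show ?thesis
      using power_le_power_Suc[of "t / real \<Delta>" k "t / real (Suc \<Delta>)"] t k by simp
  qed
  have "(real \<Delta> - 1) * ((1 + t / real \<Delta>) * (t / real \<Delta>))
      \<le> real \<Delta> * ((1 + t / real (Suc \<Delta>)) * (t / real (Suc \<Delta>)))"
    using quadratic_step[of "real \<Delta>" t] D t t_le by (simp add: add.commute)
  then have YY: "(1 + (1 + t / real \<Delta>) * (t / real \<Delta>)) ^ (\<Delta> - 1)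
      \<le> (1 + (1 + t / real (Suc \<Delta>)) * (t / real (Suc \<Delta>))) ^ \<Delta>"
    using power_le_power_Suc[of "(1 + t / real \<Delta>) * (t / real \<Delta>)" k] t unfolding k by simp
  show "\<exists>s. 0 \<le> s \<and> s \<le> r \<and> X_fin (Suc \<Delta>) r \<le> X_fin \<Delta> s \<and> Y_fin \<Delta> s \<le> Y_fin (Suc \<Delta>) r"
  proof (intro exI conjI)
    show "0 \<le> s_of \<Delta> t"
      using D t by (simp add: s_of_def)
    show "s_of \<Delta> t \<le> r"
      using s_le r_eq by simp
    have "t / (1 + t / real (Suc \<Delta>)) ^ \<Delta> \<le> t / (1 + t / real \<Delta>) ^ (\<Delta> - 1)"
      using XX t by (intro divide_left_mono mult_pos_pos zero_less_power add_pos_nonneg) auto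
    then show "X_fin (Suc \<Delta>) r \<le> X_fin \<Delta> (s_of \<Delta> t)"
      using X_fin_s_of[of "Suc \<Delta>" t] X_fin_s_of[of \<Delta> t] D t by (simp add: r_eq)
    show "Y_fin \<Delta> (s_of \<Delta> t) \<le> Y_fin (Suc \<Delta>) r"
      using mult_mono[OF step[OF t] YY] Y_fin_s_of[of "Suc \<Delta>" t] Y_fin_s_of[of \<Delta> t] D t
      by (simp add: r_eq)
  qed
qed

text \<open>As \<Delta> grows, \<open>s_of \<Delta> t\<close> tends to t, so the parameter of the
  limit system is t itself and the comparison point is again \<open>s_of \<Delta> t\<close>.\<close>

lemma Vmax_inf_le:
  assumes D: "\<Delta> \<ge> 3" and d: "d > 0"
  shows "Vmax_inf d \<le> Vmax_fin \<Delta> d"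
proof (rule girth_system_Vmax_mono)
  show "girth_system (E_fin \<Delta>) (X_fin \<Delta>) (Y_fin \<Delta>) d" "girth_system E_inf X_inf Y_inf d"
    using D d by (auto intro: girth_system_fin girth_system_inf)
  have step: "(1 + w / real \<Delta>) ^ \<Delta> \<le> exp w" if "0 \<le> w" for w
    using D that by (intro power_le_exp) auto
  then show "E_fin \<Delta> w \<le> E_inf w" if "0 \<le> w" for w
    using that by (simp add: E_fin_def E_inf_def)
  fix t :: real assume t: "0 \<le> t" "t < 1"
  show "\<exists>s. 0 \<le> s \<and> s \<le> t \<and> X_inf t \<le> X_fin \<Delta> s \<and> Y_fin \<Delta> s \<le> Y_inf t"
  proof (intro exI conjI)
    show "0 \<le> s_of \<Delta> t"
      using D t by (simp add: s_of_def)
    show "s_of \<Delta> t \<le> t"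
      unfolding s_of_def using D t by (simp add: field_simps)
    have "(1 + t / real \<Delta>) ^ (\<Delta> - 1) \<le> exp t"
      using D t by (intro power_le_exp) (auto simp: field_simps)
    then show "X_inf t \<le> X_fin \<Delta> (s_of \<Delta> t)"
      using D t by (auto simp: X_inf_def X_fin_s_of intro!: divide_left_mono mult_pos_pos zero_less_power add_pos_nonneg)
    have "real (\<Delta> - 1) * ((1 + t / real \<Delta>) * (t / real \<Delta>)) \<le> t"
    proof -
      \<comment> \<open>The right-hand side is \<Delta>^2 times the difference of the two sides of
        the goal.\<close>
      have "0 \<le> t * (real \<Delta> * (1 - t) + t)"
        using t by simp
      then show ?thesis
        using D by (simp add: of_nat_diff field_simps)
    qed
    then have "(1 + (1 + t / real \<Delta>) * (t / real \<Delta>)) ^ (\<Delta> - 1) \<le> exp t"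
      using t by (intro power_le_exp) auto
    then show "Y_fin \<Delta> (s_of \<Delta> t) \<le> Y_inf t"
      using D t step[of t] by (simp add: Y_inf_def Y_fin_s_of mult_mono)
  qed
qed

section \<open>Translation of the original constants into maxima of the systems\<close>

text \<open>For u = b^(1/\<Delta>), the bound b < \<rho> says u < (\<Delta> - 1)/(\<Delta> - 2),
  which is s < 1.\<close>

lemma U_power_surj:
  assumes D: "\<Delta> \<ge> 3" and b: "1 \<le> b" "b < rho \<Delta>"
  obtains s where "0 \<le> s" "s < 1" "b = U \<Delta> s ^ \<Delta>"
proof
  define u where "u = b powr (1 / real \<Delta>)"
  have u: "1 \<le> u" "u ^ \<Delta> = b"
    using b D by (auto simp: u_def ge_one_powr_ge_zero powr_powr simp flip: powr_realpow)
  have "u < (real \<Delta> - 1) / (real \<Delta> - 2)"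
    using b(2) u D by (intro power_less_imp_less_base[of u \<Delta>]) (auto simp: rho_def)
  then have lt: "u * (real \<Delta> - 2) < real \<Delta> - 1"
    using D by (simp add: field_simps)
  let ?s = "(real \<Delta> - 1) * (1 - 1 / u)"
  show "0 \<le> ?s"
    using u D by simp
  show "?s < 1"
    using lt u by (simp add: field_simps)
  have "U \<Delta> ?s = u"
    using u D by (simp add: U_def field_simps)
  then show "b = U \<Delta> ?s ^ \<Delta>"
    using u by simp
qed

lemma U_power_less_rho:
  assumes "\<Delta> \<ge> 3" "0 \<le> s" "s < 1"
  shows "1 \<le> U \<Delta> s ^ \<Delta>" "U \<Delta> s ^ \<Delta> < rho \<Delta>"
proof -
  have "U \<Delta> s < (real \<Delta> - 1) / (real \<Delta> - 2)"
    unfolding U_def using assms by (intro divide_strict_left_mono) auto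
  then show "U \<Delta> s ^ \<Delta> < rho \<Delta>"
    unfolding rho_def using U_ge_1[of \<Delta> s] assms by (intro power_strict_mono) auto
qed (use U_ge_1 assms in auto)

lemma U_power_powr:
  assumes "\<Delta> \<ge> 3" "0 \<le> s" "s < 1"
  shows "(U \<Delta> s ^ \<Delta>) powr (c / real \<Delta>) = U \<Delta> s powr c"
  using U_ge_1[of \<Delta> s] assms by (simp add: powr_powr flip: powr_realpow)

lemma x_fun_U:
  assumes "\<Delta> \<ge> 3" "0 \<le> s" "s < 1"
  shows "x_fun \<Delta> (U \<Delta> s ^ \<Delta>) = X_fin \<Delta> s / real \<Delta>"
    and "U \<Delta> s ^ \<Delta> * x_fun \<Delta> (U \<Delta> s ^ \<Delta>) = U \<Delta> s * (U \<Delta> s - 1)"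
proof -
  obtain k where k: "\<Delta> = Suc k"
    using assms by (cases \<Delta>) auto
  have u: "U \<Delta> s \<ge> 1"
    using U_ge_1[of \<Delta> s] assms by simp
  have x: "x_fun \<Delta> (U \<Delta> s ^ \<Delta>) = (U \<Delta> s ^ 2 - U \<Delta> s) / U \<Delta> s ^ \<Delta>"
    unfolding x_fun_def U_power_powr[OF assms] using u by simp
  show "U \<Delta> s ^ \<Delta> * x_fun \<Delta> (U \<Delta> s ^ \<Delta>) = U \<Delta> s * (U \<Delta> s - 1)"
    unfolding x using u by (simp add: field_simps power2_eq_square)
  have "(U \<Delta> s ^ 2 - U \<Delta> s) / U \<Delta> s ^ \<Delta> = (U \<Delta> s - 1) / U \<Delta> s ^ (\<Delta> - 1)"
    unfolding k using u[unfolded k] by (simp add: field_simps power2_eq_square)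
  then show "x_fun \<Delta> (U \<Delta> s ^ \<Delta>) = X_fin \<Delta> s / real \<Delta>"
    unfolding x using assms by (simp add: X_fin_def)
qed

lemma f_fun_U:
  assumes "\<Delta> \<ge> 3" "0 \<le> s" "s < 1"
  shows "f_fun \<Delta> d (U \<Delta> s ^ \<Delta>) = s ^ d / (1 - s) / (real \<Delta> - 1)"
proof -
  have "(real \<Delta> - 1) * (1 - (U \<Delta> s ^ \<Delta>) powr (- 1 / real \<Delta>)) = s"
    unfolding U_power_powr[OF assms] using U_ge_1[of \<Delta> s] assms
    by (simp add: powr_minus U_def field_simps)
  then show ?thesis
    unfolding f_fun_def by simp
qed

lemma K_fun_U:
  assumes "\<Delta> \<ge> 3" "g \<ge> 3" "0 \<le> s" "s < 1"
  shows "K_fun \<Delta> g a (U \<Delta> s ^ \<Delta>)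
    = girth_system.K (E_fin \<Delta>) (X_fin \<Delta>) (Y_fin \<Delta>) (g - 2) a s"
proof -
  interpret girth_system "E_fin \<Delta>" "X_fin \<Delta>" "Y_fin \<Delta>" "g - 2"
    using assms by (intro girth_system_fin) auto
  have choose: "real (\<Delta> choose 2) = real \<Delta> * (real \<Delta> - 1) / 2"
    using assms by (simp add: choose_two real_of_nat_div of_nat_diff)
  \<comment> \<open>The binomial coefficient absorbs both the 1/(\<Delta> - 1) of
    \<open>f_fun\<close> and the 1/\<Delta> of \<open>x_fun\<close>.\<close>
  have cancel: "c / (real \<Delta> - 1) * (real \<Delta> * (real \<Delta> - 1) / 2) * B * (x / real \<Delta>) * P = c * x * (B * P) / 2"
    for c B x P :: real
    using assms by simp
  show ?thesis
    unfolding K_fun_def K_def f_fun_U[OF assms(1,3,4)] x_fun_U(2)[OF assms(1,3,4)]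
    unfolding x_fun_U(1)[OF assms(1,3,4)] E_fin_def Y_fin_def
    unfolding choose cancel by simp
qed

text \<open>The admissible b are the powers \<open>U \<Delta> s ^ \<Delta>\<close> with 0 \<le> s
  \<le> \<open>root a\<close>, so the supremum is attained at the root.\<close>

lemma z_fun_eq:
  assumes D: "\<Delta> \<ge> 3" and g: "g \<ge> 3" and a: "a \<in> {0..1}"
  shows "z_fun \<Delta> g a = girth_system.V (E_fin \<Delta>) (X_fin \<Delta>) (Y_fin \<Delta>) (g - 2) a / real \<Delta>"
proof -
  interpret girth_system "E_fin \<Delta>" "X_fin \<Delta>" "Y_fin \<Delta>" "g - 2"
    using D g by (intro girth_system_fin) auto
  have r: "0 \<le> root a" "root a < 1" "K a (root a) = a"
    using root[of a] a by auto
  have "b_sup \<Delta> g a = U \<Delta> (root a) ^ \<Delta>"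
    unfolding b_sup_def
  proof (rule cSup_eq_maximum)
    show "U \<Delta> (root a) ^ \<Delta> \<in> {b. 1 \<le> b \<and> b < rho \<Delta> \<and> K_fun \<Delta> g a b \<le> a}"
      using U_power_less_rho[OF D r(1,2)] K_fun_U[OF D g r(1,2)] r by simp
    fix b assume "b \<in> {b. 1 \<le> b \<and> b < rho \<Delta> \<and> K_fun \<Delta> g a b \<le> a}"
    then have b: "1 \<le> b" "b < rho \<Delta>" "K_fun \<Delta> g a b \<le> a" by auto
    obtain s where s: "0 \<le> s" "s < 1" "b = U \<Delta> s ^ \<Delta>"
      using U_power_surj[OF D b(1,2)] by blast
    then have "s \<le> root a"
      using b(3) K_fun_U[OF D g s(1,2)] K_le_iff[of a s] a by simp
    then show "b \<le> U \<Delta> (root a) ^ \<Delta>"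
      unfolding s(3) using U_mono[OF D] U_ge_1[OF D, of s] s r by (intro power_mono) auto
  qed
  then show ?thesis
    by (simp add: z_fun_def V_def x_fun_U(1)[OF D r(1,2)])
qed

lemma C_const_eq:
  assumes D: "\<Delta> \<ge> 3" and g: "g \<ge> 3"
  shows "C_const \<Delta> g / real \<Delta> = inverse (Vmax_fin \<Delta> (g - 2))"
proof -
  interpret girth_system "E_fin \<Delta>" "X_fin \<Delta>" "Y_fin \<Delta>" "g - 2"
    using D g by (intro girth_system_fin) auto
  obtain a where "a \<in> {0<..<1}" "V a = Vmax"
    using Vmax_attained by blast
  then have "Vmax / real \<Delta> \<in> z_fun \<Delta> g ` {0..1}"
    using z_fun_eq[OF D g, of a] by (intro image_eqI[of _ _ a]) auto
  then have "(GREATEST m. m \<in> z_fun \<Delta> g ` {0..1}) = Vmax / real \<Delta>"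
    using z_fun_eq[OF D g] V_le_Vmax
    by (intro Greatest_equality) (auto intro: divide_right_mono)
  then show ?thesis
    using D by (simp add: C_const_def field_simps)
qed

lemma JPR_b_eq:
  assumes g: "g \<ge> 3" and a: "a \<in> {0..1}"
  shows "JPR_b g a = exp (girth_system.root E_inf X_inf Y_inf (g - 2) a)"
proof -
  interpret girth_system E_inf X_inf Y_inf "g - 2"
    using g by (intro girth_system_inf) auto
  \<comment> \<open>One factor ln b is the numerator of \<open>X_inf\<close>; the other g - 2 form
    \<open>s ^ d\<close>.\<close>
  have g1: "g - 1 = Suc (g - 2)"
    using g by simp
  \<comment> \<open>At s = 1 the fractions on both sides are divisions by zero with value 0, so the
    identity holds for every s.\<close>
  have eq: "exp ((1 - a) * ln (exp s) / exp s) - 1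
      + exp s * ln (exp s) ^ (g - 1) / (2 * (1 - ln (exp s))) = K a s" for s
    unfolding K_def E_inf_def X_inf_def Y_inf_def g1
    by (cases "s = 1") (simp_all add: field_simps)
  have r: "0 \<le> root a" "root a < 1" "K a (root a) = a"
    using root[of a] a by auto
  show ?thesis
    unfolding JPR_b_def
  proof (rule the_equality)
    show "1 \<le> exp (root a) \<and> exp (root a) < exp 1 \<and>
      exp ((1 - a) * ln (exp (root a)) / exp (root a)) - 1 +
      exp (root a) * ln (exp (root a)) ^ (g - 1) / (2 * (1 - ln (exp (root a)))) = a"
      unfolding eq using r by simp
    fix b assume b: "1 \<le> b \<and> b < exp 1 \<and>
      exp ((1 - a) * ln b / b) - 1 + b * ln b ^ (g - 1) / (2 * (1 - ln b)) = a"
    define s where "s = ln b"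
    have s: "b = exp s" "0 \<le> s" "s < 1"
      using b by (auto simp: s_def) (metis exp_gt_zero less_le_trans ln_exp ln_less_cancel_iff zero_less_one)
    then have "K a s = a"
      using b eq[of s] by simp
    then have "s = root a"
      using s r root_exists[of a] a by auto
    then show "b = exp (root a)"
      using s by simp
  qed
qed

text \<open>Inversion reverses the order of the positive values of \<open>V\<close>, and the maximum
  of \<open>V\<close> is attained inside (0, 1), so the minimum exists.\<close>

lemma JPR_const_eq:
  assumes g: "g \<ge> 3"
  shows "JPR_const g = inverse (Vmax_inf (g - 2))"
proof -
  interpret girth_system E_inf X_inf Y_inf "g - 2"
    using g by (intro girth_system_inf) auto
  have eq: "JPR_b g a / ((1 - a) * ln (JPR_b g a)) = inverse (V a)" if "a \<in> {0<..<1}" for a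
    using that JPR_b_eq[OF g, of a] by (simp add: V_def X_inf_def field_simps)
  obtain a where "a \<in> {0<..<1}" "V a = Vmax"
    using Vmax_attained by blast
  then show ?thesis
    unfolding JPR_const_def using eq V_le_Vmax V_pos
    by (intro Least_equality) (auto intro!: image_eqI[of _ _ a] le_imp_inverse_le)
qed

section \<open>Monotone convergence of the normalised constants\<close>

theorem theorem1p2:
  fixes g :: nat
  assumes "g \<ge> 3"
  shows "mono_on {3..} (\<lambda>\<Delta>. C_const \<Delta> g / real \<Delta>) \<and>
         convergent (\<lambda>\<Delta>. C_const \<Delta> g / real \<Delta>) \<and>
         lim (\<lambda>\<Delta>. C_const \<Delta> g / real \<Delta>) \<le> JPR_const g"
proof -
  let ?c = "\<lambda>\<Delta>. C_const \<Delta> g / real \<Delta>"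
  have d: "g - 2 > 0"
    using assms by simp
  have pos: "Vmax_fin \<Delta> (g - 2) > 0" if "\<Delta> \<ge> 3" for \<Delta>
    using girth_system.Vmax_pos[OF girth_system_fin[OF that d]] .
  have le_Suc: "?c \<Delta> \<le> ?c (Suc \<Delta>)" if "\<Delta> \<ge> 3" for \<Delta>
    using Vmax_fin_Suc_le[OF that d] pos[of "Suc \<Delta>"] that
    unfolding C_const_eq[OF that assms] C_const_eq[OF le_SucI[OF that] assms]
    by (intro le_imp_inverse_le) auto
  have mono: "?c m \<le> ?c n" if "3 \<le> m" "m \<le> n" for m n
    using that(2)
  proof (induction rule: dec_induct)
    case (step n)
    then show ?case
      using le_Suc[of n] that(1) by linarith
  qed simp
  have le: "?c \<Delta> \<le> JPR_const g" if "\<Delta> \<ge> 3" for \<Delta>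
    unfolding C_const_eq[OF that assms] JPR_const_eq[OF assms]
    using girth_system.Vmax_pos[OF girth_system_inf[OF d]] Vmax_inf_le[OF that d]
    by (intro le_imp_inverse_le)
  \<comment> \<open>The shift by 3 discards the degrees outside the range of the estimates and
    leaves the limit unchanged.\<close>
  have "incseq (\<lambda>n. ?c (n + 3))"
    by (intro monoI mono) auto
  moreover have "\<forall>n. ?c (n + 3) \<le> JPR_const g"
    by (intro allI le) simp
  ultimately obtain L where "(\<lambda>n. ?c (n + 3)) \<longlonglongrightarrow> L"
    by (rule incseq_convergent)
  then have L: "?c \<longlonglongrightarrow> L"
    by (rule LIMSEQ_offset)
  then have "L \<le> JPR_const g"
    using le by (intro LIMSEQ_le_const2) auto
  with L mono show ?thesis
    by (auto simp: mono_on_def convergent_def limI)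
qed

end
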